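(* Let $0\le a_1<a_2$ be integers, $\Omega=[a_1,a_1+1)\cup[a_2,a_2+1)$, and let $\mathbf N=(N,N)$ be simple for $\Omega$. Let $X=\big([a_1,a_1+1)\times[a_2,a_2+1]\big)\cup\big([a_2,a_2+1)\times[a_1,a_1+1]\big)$, and let $\overline{\mu_T}$ be the Borel probability measure on $X$ given by $\overline{\mu_T}(A)=C\iint_A\frac{N}{(N+xy)^2}\,dy\,dx$, where $C$ is the normalizing constant. For $c\in\mathbb R$ let $A_c=\{(x,y)\in X:\frac{Nx}{N+xy}\le c\}$ and $F(c)=\overline{\mu_T}(A_c)$. Then: (1) $F(c)=0$ for $c\in\left(-\infty,\frac{Na_1}{N+a_1(a_2+1)}\right]$; (2) $F(c)=C\left(\frac{c(a_2+1+\frac{N}{a_1})}{N}-1-\log\left(\frac{Nc+ca_1(a_2+1)}{a_1N}\right)\right)$ for $c\in\left(\frac{Na_1}{N+a_1(a_2+1)},\frac{Na_1}{N+a_1a_2}\right]$; (3) $F(c)=C\left(-\log\left(\frac{N+a_1(a_2+1)}{N+a_1a_2}\right)+\frac cN\right)$ for $c\in\left(\frac{Na_1}{N+a_1a_2},\frac{N(a_1+1)}{N+(a_1+1)(a_2+1)}\right]$; (4) $F(c)=C\left(\log\left(\frac{Nc+c(a_1+1)(a_2+1)}{N(a_1+1)}\cdot\frac{N+a_1a_2}{N+a_1(a_2+1)}\right)+1-\frac{c}{a_1+1}-\frac{ca_2}{N}\right)$ for $c\in\left(\frac{N(a_1+1)}{N+(a_1+1)(a_2+1)},\frac{N(a_1+1)}{N+a_2(a_1+1)}\right]$;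 (5) $F(c)=\frac12$ for $c\in\left(\frac{N(a_1+1)}{N+a_2(a_1+1)},\frac{Na_2}{N+a_2(a_1+1)}\right]$; (6) $F(c)=\frac12+C\left(\frac{c(a_1+1+\frac{N}{a_2})}{N}-1-\log\left(\frac{Nc+ca_2(a_1+1)}{a_2N}\right)\right)$ for $c\in\left(\frac{Na_2}{N+a_2(a_1+1)},\frac{Na_2}{N+a_1a_2}\right]$; (7) $F(c)=\frac12+C\left(-\log\left(\frac{N+a_2(a_1+1)}{N+a_1a_2}\right)+\frac cN\right)$ for $c\in\left(\frac{Na_2}{N+a_1a_2},\frac{N(a_2+1)}{N+(a_1+1)(a_2+1)}\right]$; (8) $F(c)=\frac12+C\left(\log\left(\frac{Nc+c(a_2+1)(a_1+1)}{N(a_2+1)}\cdot\frac{N+a_1a_2}{N+a_2(a_1+1)}\right)+1-\frac{c}{a_2+1}-\frac{ca_1}{N}\right)$ for $c\in\left(\frac{N(a_2+1)}{N+(a_1+1)(a_2+1)},\frac{N(a_2+1)}{N+a_1(a_2+1)}\right]$; (9) $F(c)=1$ for $c\in\left(\frac{N(a_2+1)}{N+a_1(a_2+1)},\infty\right)$.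
   Context: Write $I_1=[a_1,a_1+1)$, $I_2=[a_2,a_2+1)$. The pair $\mathbf N=(N,N)$, with $N$ a positive integer, is simple for $\Omega$ if (i) it is allowable: $\lfloor N/x\rfloor-a_2>0$ for all $x\in I_1$, $x\ne0$, and $\lfloor N/x\rfloor-a_1>0$ for all $x\in I_2$, $x\neq0$; and (ii) for each $i\in\{1,2\}$ with $a_i\ne0$, both $a_i\mid N$ and $a_i+1\mid N$. The normalizing constant is given by $C^{-1}=\iint_X\frac{N}{(N+xy)^2}\,dy\,dx=2\ln\left[1+\frac{N}{(N+a_1(a_2+1))(N+a_2(a_1+1))}\right]$. Here $\log=\ln$ is the natural logarithm. Some of the listed ranges $(u,v]$ may be empty (when $u=v$), in which case the corresponding formula asserts nothing; in particular, when $a_1=0$ the range in (2) is empty. *)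

theory Defs
  imports "HOL-Analysis.Analysis"
begin

definition digit_interval :: "int \<Rightarrow> real set" where
  "digit_interval a = {real_of_int a ..< real_of_int a + 1}"

text \<open>The set \<open>\<Omega>\<close> is the union of \<open>digit_interval a1\<close> and \<open>digit_interval a2\<close>; the pair is
  \<open>(N, N)\<close>. Both are represented by the integers \<open>a1\<close>, \<open>a2\<close> and \<open>N\<close>.\<close>

definition allowable_pair :: "int \<Rightarrow> int \<Rightarrow> int \<Rightarrow> bool" where
  "allowable_pair a1 a2 N \<longleftrightarrow>
     (\<forall>x \<in> digit_interval a1. x \<noteq> 0 \<longrightarrow> \<lfloor>real_of_int N / x\<rfloor> - a2 > 0) \<and>
     (\<forall>x \<in> digit_interval a2. x \<noteq> 0 \<longrightarrow> \<lfloor>real_of_int N / x\<rfloor> - a1 > 0)"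

definition simple_pair :: "int \<Rightarrow> int \<Rightarrow> int \<Rightarrow> bool" where
  "simple_pair a1 a2 N \<longleftrightarrow>
     allowable_pair a1 a2 N \<and> (\<forall>a \<in> {a1, a2}. a \<noteq> 0 \<longrightarrow> a dvd N \<and> a + 1 dvd N)"

definition ext_domain :: "int \<Rightarrow> int \<Rightarrow> (real \<times> real) set" where
  "ext_domain a1 a2 =
     digit_interval a1 \<times> {real_of_int a2 .. real_of_int a2 + 1} \<union>
     digit_interval a2 \<times> {real_of_int a1 .. real_of_int a1 + 1}"

definition ext_density :: "int \<Rightarrow> real \<times> real \<Rightarrow> real" where
  "ext_density N = (\<lambda>(x, y). real_of_int N / (real_of_int N + x * y)\<^sup>2)"

definition norm_const :: "int \<Rightarrow> int \<Rightarrow> int \<Rightarrow> real" where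
  "norm_const a1 a2 N =
     inverse (set_lebesgue_integral lborel (ext_domain a1 a2) (ext_density N))"

definition ext_measure :: "int \<Rightarrow> int \<Rightarrow> int \<Rightarrow> (real \<times> real) measure" where
  "ext_measure a1 a2 N =
     density (restrict_space lborel (ext_domain a1 a2))
       (\<lambda>p. ennreal (norm_const a1 a2 N * ext_density N p))"

definition sublevel_set :: "int \<Rightarrow> int \<Rightarrow> int \<Rightarrow> real \<Rightarrow> (real \<times> real) set" where
  "sublevel_set a1 a2 N c =
     {(x, y). (x, y) \<in> ext_domain a1 a2 \<and> real_of_int N * x / (real_of_int N + x * y) \<le> c}"

end

theory Submission
  imports Defs
begin

text \<open>On each of the two rectangles of the domain the density is integrated over the vertical sections
  of the sublevel set. For \<open>x, c > 0\<close> the inequality \<open>N x / (N + x y) \<le> c\<close> reads \<open>y \<ge> N / c - N / x\<close>, so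
  the section is the whole segment \<open>[b, b + 1]\<close>, a proper upper part of it, or null, and these cases
  follow each other from left to right, changing at \<open>N c / (N - b c)\<close> and at \<open>N c / (N - (b + 1) c)\<close>.
  The thresholds on \<open>c\<close> record where these two points lie relative to \<open>a\<close> and \<open>a + 1\<close>. Simplicity of
  \<open>(N, N)\<close> enters only through \<open>a (a + 1) \<le> N\<close>, a consequence of the coprimality of the divisors
  \<open>a\<close> and \<open>a + 1\<close> of \<open>N\<close>, which puts the thresholds in increasing order. The two rectangles have equal
  mass because their masses are given by a formula symmetric in \<open>a1\<close> and \<open>a2\<close>, and the sublevel sets
  exhaust the first rectangle before they meet the second in positive measure.\<close>

section \<open>Iterated integration over vertical sections\<close>

text \<open>Tonelli's theorem, with the section masses prescribed only on the open interval: the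
  line \<open>x = s\<close> is null, which keeps \<open>x = 0\<close> out of formulas containing
  \<open>1 / x\<close>.\<close>

lemma nn_integral_two_stage:
  fixes k :: "real \<Rightarrow> real \<Rightarrow> real" and A :: "(real \<times> real) set"
  assumes [measurable]: "A \<in> sets borel" "(\<lambda>(x, y). k x y) \<in> borel_measurable borel"
    and sub: "A \<subseteq> {s..<t} \<times> UNIV"
    and slice: "\<And>x. s < x \<Longrightarrow> x < t \<Longrightarrow> 0 \<le> g x \<and>
           (\<integral>\<^sup>+y. ennreal (k x y) * indicator A (x, y) \<partial>lborel) = ennreal (g x)"
    and int: "(g has_integral I) {s..t}"
  shows "(\<integral>\<^sup>+p. ennreal (case p of (x, y) \<Rightarrow> k x y) * indicator A p \<partial>lborel) = ennreal I"
proof -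
  define h where "h x = (\<integral>\<^sup>+y. ennreal (k x y) * indicator A (x, y) \<partial>lborel)" for x
  have meas: "(\<lambda>(x, y). ennreal (k x y) * indicator A (x, y))
      \<in> borel_measurable (lborel \<Otimes>\<^sub>M lborel)"
    unfolding lborel_prod by (simp add: case_prod_unfold)
       (use assms(1,2) in \<open>auto simp: case_prod_unfold\<close>)
  have [measurable]: "h \<in> borel_measurable borel"
    using lborel.borel_measurable_nn_integral_fst[OF meas] by (simp add: h_def[abs_def])
  have "(\<integral>\<^sup>+p. ennreal (case p of (x, y) \<Rightarrow> k x y) * indicator A p \<partial>lborel)
      = (\<integral>\<^sup>+p. (case p of (x, y) \<Rightarrow> ennreal (k x y) * indicator A (x, y)) \<partial>(lborel \<Otimes>\<^sub>M lborel))"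
    unfolding lborel_prod by (rule nn_integral_cong) auto
  also have "\<dots> = (\<integral>\<^sup>+x. h x \<partial>lborel)"
    unfolding h_def by (subst lborel.nn_integral_fst[OF meas, symmetric]) simp
  \<comment> \<open>The integrand becomes real-valued so that a gauge integral can evaluate it. Its
    measurability comes from \<open>h\<close>, its values on the interval from
    \<open>g\<close>.\<close>
  also have "\<dots> = (\<integral>\<^sup>+x. ennreal (indicator {s<..<t} x * enn2real (h x)) \<partial>lborel)"
  proof (rule nn_integral_cong_AE)
    have "AE x in lborel. x \<noteq> s" by (rule AE_lborel_singleton)
    then show "AE x in lborel. h x = ennreal (indicator {s<..<t} x * enn2real (h x))"
    proof eventually_elim
      case (elim x)
      show ?case
      proof (cases "s < x \<and> x < t")
        case True
        then show ?thesis using slice[of x] by (simp add: h_def)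
      next
        case False
        then have "(x, y) \<notin> A" for y using sub elim by auto
        then show ?thesis using False by (auto simp: h_def indicator_def)
      qed
    qed
  qed
  also have "\<dots> = ennreal I"
  proof (rule nn_integral_has_integral_lborel)
    have "(g has_integral I) {s<..<t}"
      using int by (simp add: has_integral_Icc_iff_Ioo)
    then have "((\<lambda>x. if x \<in> {s<..<t} then g x else 0) has_integral I) UNIV"
      by (simp only: has_integral_restrict_UNIV)
    moreover have "indicator {s<..<t} x * enn2real (h x) = (if x \<in> {s<..<t} then g x else 0)" for x
      using slice[of x] by (auto simp: h_def)
    ultimately show "((\<lambda>x. indicator {s<..<t} x * enn2real (h x)) has_integral I) UNIV"
      by simp
  qed auto
  finally show ?thesis .
qed

section \<open>Vertical sections of the sublevel set in one rectangle\<close>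

text \<open>The rectangle is \<open>{a..<a + 1} \<times> {b..b + 1}\<close>. No order between
  \<open>a\<close> and \<open>b\<close> is assumed, so that both rectangles of the domain are
  instances, with the roles exchanged.\<close>

locale block =
  fixes N a b :: real
  assumes N_pos: "0 < N" and a_nonneg: "0 \<le> a" and b_nonneg: "0 \<le> b" and a_le: "a * (a + 1) \<le> N"
begin

lemma pos: "0 \<le> x \<Longrightarrow> 0 \<le> y \<Longrightarrow> 0 < N + x * y"
  using N_pos by (simp add: add_pos_nonneg)

text \<open>The antiderivative \<open>y / (N + x * y)\<close> differs by the constant
  \<open>1 / x\<close> from the more obvious \<open>- N / (x * (N + x * y))\<close> and stays valid
  at \<open>x = 0\<close>.\<close>

lemma nn_integral_section:
  assumes "0 \<le> x" "0 \<le> l" "l \<le> u"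
  shows "(\<integral>\<^sup>+y. ennreal (N / (N + x * y)\<^sup>2) * indicator {l..u} y \<partial>lborel)
    = ennreal (u / (N + x * u) - l / (N + x * l))"
proof (rule nn_integral_FTC_Icc)
  fix y assume "y \<in> {l..u}"
  then have "N + x * y \<noteq> 0" using pos[of x y] assms by simp
  then show "((\<lambda>y. y / (N + x * y)) has_real_derivative N / (N + x * y)\<^sup>2) (at y)"
    by (auto intro!: derivative_eq_intros simp: power2_eq_square algebra_simps)
qed (use assms N_pos in auto)

definition region :: "real \<Rightarrow> (real \<times> real) set" where
  "region c = {(x, y). x \<in> {a..<a + 1} \<and> y \<in> {b..b + 1} \<and> N * x / (N + x * y) \<le> c}"

definition full_section :: "real \<Rightarrow> real" where
  "full_section x = (b + 1) / (N + x * (b + 1)) - b / (N + x * b)"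

text \<open>The mass of the section \<open>{l..b + 1}\<close> with \<open>l = N / c - N / x\<close>.\<close>

definition cut_section :: "real \<Rightarrow> real \<Rightarrow> real" where
  "cut_section c x = (b + 1) / (N + x * (b + 1)) - 1 / x + c / x\<^sup>2"

text \<open>The tests say that the lower and the upper end of the section satisfy the sublevel
  inequality. Denominators are cleared, so the tests make sense for every real \<open>c\<close>. For
  \<open>x > 0\<close> the quotient decreases in \<open>y\<close>; hence the lower end is tested
  first.\<close>

definition section_mass :: "real \<Rightarrow> real \<Rightarrow> real" where
  "section_mass c x = (if x * (N - b * c) \<le> N * c then full_section x
     else if x * (N - (b + 1) * c) \<le> N * c then cut_section c x else 0)"

lemma region_section:
  assumes "a < x" "x < a + 1"
  shows "(x, y) \<in> region c \<longleftrightarrow> b \<le> y \<and> y \<le> b + 1 \<and> x * (N - y * c) \<le> N * c"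
proof (cases "b \<le> y \<and> y \<le> b + 1")
  case True
  then have "N + x * y > 0" using pos[of x y] assms a_nonneg b_nonneg by simp
  then show ?thesis using True assms by (auto simp: region_def field_simps)
qed (auto simp: region_def)

lemma nn_integral_region_section:
  assumes "a < x" "x < a + 1"
  shows "0 \<le> section_mass c x \<and>
    (\<integral>\<^sup>+y. ennreal (N / (N + x * y)\<^sup>2) * indicator (region c) (x, y) \<partial>lborel) = ennreal (section_mass c x)"
proof -
  have x: "0 < x" using assms a_nonneg by simp
  \<comment> \<open>This monotonicity makes the section masses nonnegative.\<close>
  have incr: "l / (N + x * l) \<le> u / (N + x * u)" if "0 \<le> l" "l \<le> u" for l u
    using pos[of x l] pos[of x u] that x N_pos by (simp add: divide_simps) (simp add: algebra_simps)
  consider "x * (N - b * c) \<le> N * c"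
    | "N * c < x * (N - b * c)" "x * (N - (b + 1) * c) \<le> N * c"
    | "N * c < x * (N - b * c)" "N * c < x * (N - (b + 1) * c)" by linarith
  then show ?thesis
  proof cases
    case 1
    \<comment> \<open>For \<open>c \<le> 0\<close> the left side of the case assumption would be
      positive and the right side at most 0.\<close>
    have c: "0 < c"
    proof (rule ccontr)
      assume "\<not> 0 < c"
      then have "b * c \<le> 0" "N * c \<le> 0" using b_nonneg N_pos by (auto simp: mult_le_0_iff)
      moreover have "0 < x * (N - b * c)" using \<open>b * c \<le> 0\<close> N_pos x by simp
      ultimately show False using 1 by simp
    qed
    have "(x, y) \<in> region c \<longleftrightarrow> y \<in> {b..b + 1}" for y
    proof -
      have "x * (N - y * c) \<le> x * (N - b * c)" if "b \<le> y"
        using that x c by simp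
      then show ?thesis using 1 by (auto simp: region_section[OF assms])
    qed
    then have "(\<integral>\<^sup>+y. ennreal (N / (N + x * y)\<^sup>2) * indicator (region c) (x, y) \<partial>lborel)
      = (\<integral>\<^sup>+y. ennreal (N / (N + x * y)\<^sup>2) * indicator {b..b + 1} y \<partial>lborel)"
      by (simp add: indicator_def)
    also have "\<dots> = ennreal (section_mass c x)"
      using 1 x b_nonneg by (subst nn_integral_section) (auto simp: section_mass_def full_section_def)
    finally show ?thesis
      using 1 incr[of b "b + 1"] b_nonneg by (auto simp: section_mass_def full_section_def)
  next
    case 2
    have c: "0 < c"
    proof (rule ccontr)
      assume "\<not> 0 < c"
      then have "(b + 1) * c \<le> 0" "N * c \<le> 0" using b_nonneg N_pos by (auto simp: mult_le_0_iff)
      moreover have "0 < x * (N - (b + 1) * c)" using \<open>(b + 1) * c \<le> 0\<close> N_pos x by simp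
      ultimately show False using 2 by simp
    qed
    \<comment> \<open>The height at which the level curve meets the vertical line through
      \<open>x\<close>.\<close>
    define l where "l = N / c - N / x"
    have cond: "x * (N - z * c) \<le> N * c \<longleftrightarrow> l \<le> z" for z
      using x c by (simp add: l_def field_simps)
    have l: "b \<le> l" "l \<le> b + 1"
      using 2 cond[of b] cond[of "b + 1"] by linarith+
    then have "(x, y) \<in> region c \<longleftrightarrow> y \<in> {l..b + 1}" for y
      by (auto simp: region_section[OF assms] cond)
    then have "(\<integral>\<^sup>+y. ennreal (N / (N + x * y)\<^sup>2) * indicator (region c) (x, y) \<partial>lborel)
      = (\<integral>\<^sup>+y. ennreal (N / (N + x * y)\<^sup>2) * indicator {l..b + 1} y \<partial>lborel)"
      by (simp add: indicator_def)
    also have "\<dots> = ennreal ((b + 1) / (N + x * (b + 1)) - l / (N + x * l))"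
      using x b_nonneg l by (subst nn_integral_section) auto
    finally have int: "(\<integral>\<^sup>+y. ennreal (N / (N + x * y)\<^sup>2) * indicator (region c) (x, y) \<partial>lborel)
      = ennreal ((b + 1) / (N + x * (b + 1)) - l / (N + x * l))" .
    have "N + x * l = N * x / c" using x c by (simp add: l_def field_simps)
    then have "l / (N + x * l) = 1 / x - c / x\<^sup>2"
      using x c N_pos by (simp add: l_def field_simps power2_eq_square)
    then show ?thesis
      using 2 int incr[of l "b + 1"] b_nonneg l by (auto simp: section_mass_def cut_section_def)
  next
    case 3
    have "(x, y) \<notin> region c" for y
    proof
      assume "(x, y) \<in> region c"
      then have y: "b \<le> y" "y \<le> b + 1" "x * (N - y * c) \<le> N * c"
        by (auto simp: region_section[OF assms])
      show False
      \<comment> \<open>The expression \<open>x * (N - y * c)\<close> is affine in \<open>y\<close>,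
        with its minimum over the section at \<open>b + 1\<close> or at \<open>b\<close> according
        to the sign of \<open>c\<close>. Both ends fail the test, so every \<open>y\<close>
        does.\<close>
      proof (cases "c \<ge> 0")
        case True
        then have "x * (N - (b + 1) * c) \<le> x * (N - y * c)"
          using x y by (simp add: mult_right_mono)
        then show False using 3 y by simp
      next
        case False
        then have "x * (N - b * c) \<le> x * (N - y * c)"
          using x y by (simp add: mult_right_mono_neg)
        then show False using 3 y by simp
      qed
    qed
    then show ?thesis using 3 by (simp add: section_mass_def)
  qed
qed

lemma region_measurable: "region c \<in> sets borel"
proof -
  have "region c = {p \<in> space borel. a \<le> fst p \<and> fst p < a + 1 \<and> b \<le> snd p \<and> snd p \<le> b + 1 \<and>
      N * fst p / (N + fst p * snd p) \<le> c}"
    by (auto simp: region_def)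
  also have "\<dots> \<in> sets (borel :: (real \<times> real) measure)"
    unfolding borel_prod[symmetric] by measurable
  finally show ?thesis .
qed

lemma nn_integral_region:
  assumes "(section_mass c has_integral I) {a..a + 1}"
  shows "(\<integral>\<^sup>+p. ennreal (case p of (x, y) \<Rightarrow> N / (N + x * y)\<^sup>2) * indicator (region c) p \<partial>lborel) = ennreal I"
proof (rule nn_integral_two_stage[OF region_measurable _ _ nn_integral_region_section assms])
  show "(\<lambda>(x, y). N / (N + x * y)\<^sup>2) \<in> borel_measurable (borel :: (real \<times> real) measure)"
    unfolding borel_prod[symmetric] by measurable
  show "region c \<subseteq> {a..<a + 1} \<times> UNIV" by (auto simp: region_def)
qed

section \<open>Antiderivatives and integration in \<open>x\<close>\<close>

definition full_prim :: "real \<Rightarrow> real" where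
  "full_prim x = ln (N + x * (b + 1)) - ln (N + x * b)"

definition cut_prim :: "real \<Rightarrow> real \<Rightarrow> real" where
  "cut_prim c x = ln (N + x * (b + 1)) - ln x - c / x"

lemma full_section_has_integral:
  assumes "0 \<le> u" "u \<le> v"
  shows "(full_section has_integral full_prim v - full_prim u) {u..v}"
proof (rule fundamental_theorem_of_calculus[OF assms(2)])
  fix x assume "x \<in> {u..v}"
  then have "0 < N + x * (b + 1)" "0 < N + x * b"
    using pos[of x b] pos[of x "b + 1"] assms b_nonneg by auto
  then have "(full_prim has_real_derivative full_section x) (at x within {u..v})"
    unfolding full_prim_def[abs_def] full_section_def
    by (auto intro!: derivative_eq_intros)
  then show "(full_prim has_vector_derivative full_section x) (at x within {u..v})"
    by (simp add: has_real_derivative_iff_has_vector_derivative)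
qed

lemma cut_section_has_integral:
  assumes "0 < u" "u \<le> v"
  shows "(cut_section c has_integral cut_prim c v - cut_prim c u) {u..v}"
proof (rule fundamental_theorem_of_calculus[OF assms(2)])
  fix x assume "x \<in> {u..v}"
  then have "0 < N + x * (b + 1)" "0 < x"
    using pos[of x "b + 1"] assms b_nonneg by auto
  then have "(cut_prim c has_real_derivative cut_section c x) (at x within {u..v})"
    unfolding cut_prim_def[abs_def] cut_section_def
    by (auto intro!: derivative_eq_intros simp: power2_eq_square)
  then show "(cut_prim c has_vector_derivative cut_section c x) (at x within {u..v})"
    by (simp add: has_real_derivative_iff_has_vector_derivative)
qed

text \<open>The interval is cut at \<open>u\<close> and \<open>v\<close> into full, cut and empty
  sections. Any of the three pieces may degenerate, so one formula serves all ranges of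
  \<open>c\<close>. The values at the cut points form a finite set and do not affect the integral.
  The condition \<open>0 < u \<or> u = v\<close> keeps the pole of \<open>cut_section\<close> at 0
  out of a nontrivial middle piece.\<close>

lemma section_mass_has_integral:
  assumes order: "a \<le> u" "u \<le> v" "v \<le> a + 1" and "0 < u \<or> u = v"
    and full: "\<And>x. a < x \<Longrightarrow> x < u \<Longrightarrow> x * (N - b * c) \<le> N * c"
    and cut: "\<And>x. u < x \<Longrightarrow> x < v \<Longrightarrow> N * c < x * (N - b * c) \<and> x * (N - (b + 1) * c) \<le> N * c"
    and empty: "\<And>x. v < x \<Longrightarrow> x < a + 1 \<Longrightarrow> N * c < x * (N - b * c) \<and> N * c < x * (N - (b + 1) * c)"
  shows "(section_mass c has_integral (full_prim u - full_prim a) + (cut_prim c v - cut_prim c u)) {a..a + 1}"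
proof -
  have "(section_mass c has_integral full_prim u - full_prim a) {a..u}"
    by (rule has_integral_spike_finite[OF _ _ full_section_has_integral, of "{a, u}"])
       (use order a_nonneg full in \<open>auto simp: section_mass_def\<close>)
  moreover have "(section_mass c has_integral cut_prim c v - cut_prim c u) {u..v}"
  proof (cases "u = v")
    case False
    then have "0 < u" using assms(4) by simp
    have "section_mass c x = cut_section c x" if "u < x" "x < v" for x
      using cut[OF that] by (simp add: section_mass_def)
    then show ?thesis
      using order by (intro has_integral_spike_finite[OF _ _ cut_section_has_integral[OF \<open>0 < u\<close>],
        of "{u, v}"]) auto
  qed (use has_integral_refl in simp)
  moreover have "(section_mass c has_integral 0) {v..a + 1}"
  proof (rule has_integral_spike_finite[OF _ _ has_integral_0, of "{v, a + 1}"])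
    fix x assume "x \<in> {v..a + 1} - {v, a + 1}"
    then show "section_mass c x = 0" using empty[of x] by (simp add: section_mass_def)
  qed simp
  ultimately have "(section_mass c has_integral
      (full_prim u - full_prim a) + (cut_prim c v - cut_prim c u) + 0) {a..a + 1}"
    using order by (meson has_integral_combine order_trans)
  then show ?thesis by simp
qed

section \<open>Closed formulas by range of \<open>c\<close>\<close>

text \<open>The thresholds are the values of \<open>N * x / (N + x * y)\<close> at the corners
  \<open>(a, b + 1)\<close>, \<open>(a, b)\<close>, \<open>(a + 1, b + 1)\<close>,
  \<open>(a + 1, b)\<close>, in this order. The quotient decreases in \<open>y\<close>, which gives
  the first and third inequality. Cross-multiplied, the second is exactly
  \<open>a * (a + 1) \<le> N\<close>.\<close>

lemma threshold_mono:
  shows "N * a / (N + a * (b + 1)) \<le> N * a / (N + a * b)"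
    and "N * a / (N + a * b) \<le> N * (a + 1) / (N + (a + 1) * (b + 1))"
    and "N * (a + 1) / (N + (a + 1) * (b + 1)) \<le> N * (a + 1) / (N + b * (a + 1))"
proof -
  have p: "0 < N + a * (b + 1)" "0 < N + a * b" "0 < N + (a + 1) * (b + 1)" "0 < N + b * (a + 1)"
    using a_nonneg b_nonneg by (auto intro!: pos)
  show "N * a / (N + a * (b + 1)) \<le> N * a / (N + a * b)"
    using p N_pos a_nonneg by (intro divide_left_mono mult_pos_pos) (simp_all add: mult_left_mono)
  show "N * (a + 1) / (N + (a + 1) * (b + 1)) \<le> N * (a + 1) / (N + b * (a + 1))"
    using p N_pos a_nonneg by (intro divide_left_mono mult_pos_pos) (simp_all add: mult.commute[of b] mult_left_mono)
  have "a * (N + (a + 1) * (b + 1)) \<le> (a + 1) * (N + a * b)"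
    using a_le by (simp add: algebra_simps)
  then have "N * (a * (N + (a + 1) * (b + 1))) \<le> N * ((a + 1) * (N + a * b))"
    using N_pos by simp
  then show "N * a / (N + a * b) \<le> N * (a + 1) / (N + (a + 1) * (b + 1))"
    using p by (simp add: divide_simps mult.assoc)
qed

text \<open>The quotient increases in \<open>x\<close> and decreases in \<open>y\<close>, so its
  minimum over the closed rectangle is at \<open>(a, b + 1)\<close>. For \<open>c\<close> up to that
  value only points with \<open>x = a\<close> can lie in the region.\<close>

lemma section_mass_below:
  assumes "c \<le> N * a / (N + a * (b + 1))"
  shows "(section_mass c has_integral 0) {a..a + 1}"
proof -
  have "0 < N + a * (b + 1)" using a_nonneg b_nonneg by (intro pos) auto
  then have le: "N * c \<le> a * (N - (b + 1) * c)"
    using assms by (simp add: field_simps)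
  have gt: "N * c < x * (N - d * c)" if "a < x" "0 \<le> d" "d \<le> b + 1" for x d
  proof (cases "0 < c")
    case True
    then have "0 < a * (N - (b + 1) * c)" using le N_pos by (smt (verit) mult_pos_pos)
    then have "0 < N - (b + 1) * c" using a_nonneg by (simp add: zero_less_mult_iff)
    then have "a * (N - (b + 1) * c) < x * (N - (b + 1) * c)" using that by simp
    also have "\<dots> \<le> x * (N - d * c)" using that True a_nonneg by simp
    finally show ?thesis using le by simp
  next
    case False
    then have "N * c \<le> 0" "d * c \<le> 0" using N_pos that by (auto simp: mult_le_0_iff)
    moreover have "0 < x * (N - d * c)" using \<open>d * c \<le> 0\<close> that N_pos a_nonneg by simp
    ultimately show ?thesis by simp
  qed
  show ?thesis
    using section_mass_has_integral[of a a c] gt a_nonneg b_nonneg by auto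
qed

text \<open>For \<open>c > 0\<close> these inequalities place the crossing of the level curve with
  the height \<open>d\<close> at a positive abscissa \<open>N * c / (N - d * c)\<close> that is at
  most \<open>a + 1\<close>.\<close>

lemma threshold_high_pos:
  assumes "0 \<le> d" "c \<le> N * (a + 1) / (N + (a + 1) * d)"
  shows "d * c < N" "N * c \<le> (a + 1) * (N - d * c)"
proof -
  have p: "0 < N + (a + 1) * d" using a_nonneg assms by (intro pos) auto
  then show *: "N * c \<le> (a + 1) * (N - d * c)"
    using assms by (simp add: field_simps)
  show "d * c < N"
  proof (cases "c \<le> 0")
    case True
    then show ?thesis using assms N_pos by (smt (verit) mult_nonneg_nonpos)
  next
    case False
    then have "0 < (a + 1) * (N - d * c)" using * N_pos by (smt (verit) mult_pos_pos)
    then show ?thesis using a_nonneg by (simp add: zero_less_mult_iff)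
  qed
qed

text \<open>The maximum of the quotient over the closed rectangle is at \<open>(a + 1, b)\<close>;
  once \<open>c\<close> exceeds it, every section is full.\<close>

lemma section_mass_above:
  assumes "N * (a + 1) / (N + b * (a + 1)) < c"
  shows "(section_mass c has_integral full_prim (a + 1) - full_prim a) {a..a + 1}"
proof -
  have p: "0 < N + b * (a + 1)" using a_nonneg b_nonneg by (intro pos) auto
  then have le: "(a + 1) * (N - b * c) \<le> N * c"
    using assms by (simp add: field_simps)
  have c: "0 < c" using assms p a_nonneg N_pos by (smt (verit) divide_nonneg_pos mult_nonneg_nonneg)
  have "x * (N - b * c) \<le> N * c" if "a < x" "x < a + 1" for x
  \<comment> \<open>For large \<open>c\<close> the factor \<open>N - b * c\<close> is negative and
    monotonicity in \<open>x\<close> is lost, but then the left side is not positive.\<close>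
  proof (cases "0 \<le> N - b * c")
    case True
    then have "x * (N - b * c) \<le> (a + 1) * (N - b * c)" using that by (intro mult_right_mono) auto
    then show ?thesis using le by simp
  next
    case False
    then have "x * (N - b * c) \<le> 0" using that a_nonneg by (simp add: mult_nonneg_nonpos)
    then show ?thesis using c N_pos by (smt (verit) mult_pos_pos)
  qed
  then show ?thesis
    using section_mass_has_integral[of "a + 1" "a + 1" c] a_nonneg by auto
qed

text \<open>The condition on \<open>x\<close> says that the level curve \<open>N x / (N + x y) = c\<close> passes through \<open>(x, d)\<close>;
  these identities remove the abscissa \<open>x\<close> from the closed formulas.\<close>

lemma boundary_point:
  assumes "0 < c" "0 < x" "x * (N - d * c) = N * c"
  shows "ln (N + x * d) = ln N + ln x - ln c" and "c / x = 1 - c * d / N"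
proof -
  have "N + x * d = N * x / c" using assms by (simp add: field_simps)
  then show "ln (N + x * d) = ln N + ln x - ln c"
    using assms N_pos by (simp add: ln_mult ln_div)
  show "c / x = 1 - c * d / N"
    using assms N_pos by (simp add: field_simps)
qed

text \<open>The level curve rises from the left edge to the top edge, which it meets at abscissa
  \<open>q\<close>. The sections are cut on \<open>{a..q}\<close> and null beyond.\<close>

lemma section_mass_low:
  assumes "N * a / (N + a * (b + 1)) < c" "c \<le> N * a / (N + a * b)"
  shows "(section_mass c has_integral
    c * (b + 1 + N / a) / N - 1 - ln ((N * c + c * a * (b + 1)) / (a * N))) {a..a + 1}"
proof -
  have p: "0 < N + a * (b + 1)" "0 < N + a * b"
    using a_nonneg b_nonneg by (auto intro!: pos)
  \<comment> \<open>For \<open>a = 0\<close> both bounds on \<open>c\<close> are 0 and the range is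
    empty.\<close>
  have a: "0 < a" using assms a_nonneg by (cases "a = 0") auto
  have c: "0 < c" using assms p a N_pos by (smt (verit) divide_nonneg_pos mult_nonneg_nonneg)
  have "c \<le> N * (a + 1) / (N + (a + 1) * (b + 1))"
    using assms threshold_mono by linarith
  from threshold_high_pos[OF _ this] b_nonneg
  have d: "0 < N - (b + 1) * c" and e: "N * c \<le> (a + 1) * (N - (b + 1) * c)" by auto
  define q where "q = N * c / (N - (b + 1) * c)"
  have lo: "a * (N - (b + 1) * c) < N * c" and hi: "N * c \<le> a * (N - b * c)"
    using assms p by (auto simp: field_simps)
  have q: "a \<le> q" "q \<le> a + 1" "q > 0"
    using lo e d c N_pos by (auto simp: q_def field_simps)
  have db: "N - b * c > 0" using d c by (simp add: algebra_simps)
  have cut: "N * c < x * (N - b * c)" if "a < x" for x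
    using hi mult_strict_right_mono[OF that db] by simp
  have low: "x * (N - (b + 1) * c) \<le> N * c \<longleftrightarrow> x \<le> q" for x
    using d by (simp add: q_def field_simps)
  have int: "(section_mass c has_integral cut_prim c q - cut_prim c a) {a..a + 1}"
    using section_mass_has_integral[of a q c] q a cut low by (force simp: not_le[symmetric])
  have "q * (N - (b + 1) * c) = N * c" using d by (simp add: q_def)
  note boundary_point[OF c \<open>0 < q\<close> this]
  moreover have "ln ((N * c + c * a * (b + 1)) / (a * N)) = ln c + ln (N + a * (b + 1)) - ln a - ln N"
  proof -
    have "N * c + c * a * (b + 1) = c * (N + a * (b + 1))" by (simp add: algebra_simps)
    then show ?thesis using c p a N_pos by (simp add: ln_mult ln_div)
  qed
  moreover have "c * (b + 1 + N / a) / N = c * (b + 1) / N + c / a"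
    using N_pos by (simp add: field_simps)
  ultimately have "cut_prim c q - cut_prim c a =
      c * (b + 1 + N / a) / N - 1 - ln ((N * c + c * a * (b + 1)) / (a * N))"
    by (simp add: cut_prim_def)
  with int show ?thesis by simp
qed

text \<open>The level curve rises from the bottom edge at \<open>p'\<close> to the top edge at
  \<open>q\<close>. All logarithms involving \<open>p'\<close> or \<open>q\<close> cancel, and
  \<open>c / p' - c / q\<close> leaves \<open>c / N\<close>.\<close>

lemma section_mass_mid:
  assumes "N * a / (N + a * b) < c" "c \<le> N * (a + 1) / (N + (a + 1) * (b + 1))"
  shows "(section_mass c has_integral
    - ln ((N + a * (b + 1)) / (N + a * b)) + c / N) {a..a + 1}"
proof -
  have p: "0 < N + a * (b + 1)" "0 < N + a * b"
    using a_nonneg b_nonneg by (auto intro!: pos)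
  have c: "0 < c" using assms p a_nonneg N_pos by (smt (verit) divide_nonneg_pos mult_nonneg_nonneg)
  from threshold_high_pos[OF _ assms(2)] b_nonneg
  have d: "0 < N - (b + 1) * c" and e: "N * c \<le> (a + 1) * (N - (b + 1) * c)" by auto
  have db: "N - b * c > 0" using d c by (simp add: algebra_simps)
  define p' where "p' = N * c / (N - b * c)"
  define q where "q = N * c / (N - (b + 1) * c)"
  have hi: "a * (N - b * c) < N * c" using assms p by (auto simp: field_simps)
  have q: "a \<le> p'" "p' \<le> q" "q \<le> a + 1" "p' > 0" "q > 0"
    using hi e d db c N_pos by (auto simp: q_def p'_def intro!: divide_left_mono) (auto simp: field_simps)
  have cut: "x * (N - b * c) \<le> N * c \<longleftrightarrow> x \<le> p'" for x
    using db by (simp add: p'_def field_simps)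
  have low: "x * (N - (b + 1) * c) \<le> N * c \<longleftrightarrow> x \<le> q" for x
    using d by (simp add: q_def field_simps)
  have int: "(section_mass c has_integral
      (full_prim p' - full_prim a) + (cut_prim c q - cut_prim c p')) {a..a + 1}"
    by (rule section_mass_has_integral) (use q in \<open>auto simp: cut low not_le[symmetric]\<close>)
  have "q * (N - (b + 1) * c) = N * c" "p' * (N - b * c) = N * c"
    using d db by (simp_all add: q_def p'_def)
  note boundary_point[OF c \<open>0 < q\<close> this(1)] boundary_point[OF c \<open>0 < p'\<close> this(2)]
  moreover have "c * (b + 1) / N = c * b / N + c / N" by (simp add: distrib_left add_divide_distrib)
  moreover have "ln ((N + a * (b + 1)) / (N + a * b)) = ln (N + a * (b + 1)) - ln (N + a * b)"
    using p by (simp add: ln_div)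
  ultimately have "(full_prim p' - full_prim a) + (cut_prim c q - cut_prim c p') =
      - ln ((N + a * (b + 1)) / (N + a * b)) + c / N"
    unfolding cut_prim_def full_prim_def by linarith
  with int show ?thesis by simp
qed

text \<open>The level curve rises from the bottom edge at \<open>p'\<close> to the right edge:
  sections are full up to \<open>p'\<close> and cut from there to \<open>a + 1\<close>.\<close>

lemma section_mass_high:
  assumes "N * (a + 1) / (N + (a + 1) * (b + 1)) < c" "c \<le> N * (a + 1) / (N + b * (a + 1))"
  shows "(section_mass c has_integral
    ln ((N * c + c * (a + 1) * (b + 1)) / (N * (a + 1)) * ((N + a * b) / (N + a * (b + 1))))
      + 1 - c / (a + 1) - c * b / N) {a..a + 1}"
proof -
  have p: "0 < N + a * (b + 1)" "0 < N + a * b" "0 < N + (a + 1) * (b + 1)"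
    using a_nonneg b_nonneg by (auto intro!: pos)
  have c: "0 < c" using assms p a_nonneg N_pos by (smt (verit) divide_nonneg_pos mult_nonneg_nonneg)
  have db: "N - b * c > 0" and e: "N * c \<le> (a + 1) * (N - b * c)"
    using threshold_high_pos[of b c] assms b_nonneg by (auto simp: mult.commute)
  define p' where "p' = N * c / (N - b * c)"
  \<comment> \<open>The order of the corner values guarantees that the bottom crossing is not to the
    left of \<open>a\<close>.\<close>
  have "N * a / (N + a * b) < c" using assms threshold_mono(2) by linarith
  then have hi: "a * (N - b * c) < N * c"
    using p by (simp add: field_simps)
  have lo: "(a + 1) * (N - (b + 1) * c) < N * c"
    using assms p by (auto simp: field_simps)
  have q: "a \<le> p'" "p' \<le> a + 1" "p' > 0"
    using hi e db c N_pos by (auto simp: p'_def field_simps)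
  have cut: "x * (N - b * c) \<le> N * c \<longleftrightarrow> x \<le> p'" for x
    using db by (simp add: p'_def field_simps)
  have low: "x * (N - (b + 1) * c) \<le> N * c" if "0 < x" "x < a + 1" for x
  proof (cases "0 \<le> N - (b + 1) * c")
    case True
    then have "x * (N - (b + 1) * c) \<le> (a + 1) * (N - (b + 1) * c)"
      using that by (intro mult_right_mono) auto
    then show ?thesis using lo by simp
  next
    case False
    then have "x * (N - (b + 1) * c) \<le> 0" using that by (simp add: mult_nonneg_nonpos)
    then show ?thesis using c N_pos by (smt (verit) mult_pos_pos)
  qed
  have int: "(section_mass c has_integral
      (full_prim p' - full_prim a) + (cut_prim c (a + 1) - cut_prim c p')) {a..a + 1}"
    by (rule section_mass_has_integral) (use q low in \<open>auto simp: cut not_le[symmetric]\<close>)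
  have "p' * (N - b * c) = N * c" using db by (simp add: p'_def)
  note boundary_point[OF c \<open>0 < p'\<close> this]
  moreover have "ln ((N * c + c * (a + 1) * (b + 1)) / (N * (a + 1)) * ((N + a * b) / (N + a * (b + 1))))
     = ln c + ln (N + (a + 1) * (b + 1)) - ln N - ln (a + 1) + ln (N + a * b) - ln (N + a * (b + 1))"
  proof -
    have "N * c + c * (a + 1) * (b + 1) = c * (N + (a + 1) * (b + 1))" by (simp add: algebra_simps)
    then show ?thesis using c p a_nonneg N_pos by (simp add: ln_mult ln_div)
  qed
  ultimately have "(full_prim p' - full_prim a) + (cut_prim c (a + 1) - cut_prim c p') =
      ln ((N * c + c * (a + 1) * (b + 1)) / (N * (a + 1)) * ((N + a * b) / (N + a * (b + 1))))
        + 1 - c / (a + 1) - c * b / N"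
    unfolding cut_prim_def full_prim_def by linarith
  with int show ?thesis by simp
qed

section \<open>Sign and total mass for one rectangle\<close>

lemma section_mass_integral_nonneg:
  assumes "(section_mass c has_integral I) {a..a + 1}"
  shows "0 \<le> I"
proof (rule has_integral_nonneg)
  show "(section_mass c has_integral I) {a<..<a + 1}"
    using assms by (simp add: has_integral_Icc_iff_Ioo)
qed (use nn_integral_region_section in auto)

text \<open>Expanding the logarithms exhibits the symmetry in \<open>a\<close> and \<open>b\<close>
  that makes the two rectangles equally heavy.\<close>

lemma full_mass_eq:
  "full_prim (a + 1) - full_prim a =
    ln (N + (a + 1) * (b + 1)) - ln (N + (a + 1) * b) - ln (N + a * (b + 1)) + ln (N + a * b)"
  by (simp add: full_prim_def)

lemma full_mass_pos: "0 < full_prim (a + 1) - full_prim a"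
proof -
  have p: "0 < N + a * (b + 1)" "0 < N + a * b" "0 < N + (a + 1) * (b + 1)" "0 < N + (a + 1) * b"
    using a_nonneg b_nonneg by (auto intro!: pos)
  \<comment> \<open>The two products differ by exactly \<open>N\<close>.\<close>
  have "(N + (a + 1) * b) * (N + a * (b + 1)) < (N + (a + 1) * (b + 1)) * (N + a * b)"
    using N_pos by (simp add: algebra_simps)
  then have "ln ((N + (a + 1) * b) * (N + a * (b + 1))) < ln ((N + (a + 1) * (b + 1)) * (N + a * b))"
    using p by (intro ln_less_cancel_iff[THEN iffD2] mult_pos_pos)
  then show ?thesis using p by (simp add: full_mass_eq ln_mult)
qed

end

section \<open>Both rectangles together and the normalizing constant\<close>

locale two_blocks =
  fixes N a1 a2 :: int
  assumes N_pos: "0 < N" and a1_nonneg: "0 \<le> a1" and a1_less: "a1 < a2"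
    and a2_le: "a2 * (a2 + 1) \<le> N"
begin

sublocale lo: block "real_of_int N" "real_of_int a1" "real_of_int a2"
proof
  have "a1 * (a1 + 1) \<le> a2 * (a2 + 1)" using a1_nonneg a1_less by (intro mult_mono) auto
  then have "a1 * (a1 + 1) \<le> N" using a2_le by simp
  then have "real_of_int (a1 * (a1 + 1)) \<le> real_of_int N" by (simp only: of_int_le_iff)
  then show "real_of_int a1 * (real_of_int a1 + 1) \<le> real_of_int N" by simp
qed (use N_pos a1_nonneg a1_less in auto)

sublocale hi: block "real_of_int N" "real_of_int a2" "real_of_int a1"
proof
  have "real_of_int (a2 * (a2 + 1)) \<le> real_of_int N" using a2_le by (simp only: of_int_le_iff)
  then show "real_of_int a2 * (real_of_int a2 + 1) \<le> real_of_int N" by simp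
qed (use N_pos a1_nonneg a1_less in auto)

abbreviation full_mass :: real where
  "full_mass \<equiv> lo.full_prim (real_of_int a1 + 1) - lo.full_prim (real_of_int a1)"

lemma hi_full_mass: "hi.full_prim (real_of_int a2 + 1) - hi.full_prim (real_of_int a2) = full_mass"
  unfolding lo.full_mass_eq hi.full_mass_eq by (simp add: mult.commute)

lemma a1_plus_le: "real_of_int a1 + 1 \<le> real_of_int a2"
  using a1_less by linarith

lemma sublevel_eq: "sublevel_set a1 a2 N c = lo.region c \<union> hi.region c"
  by (auto simp: sublevel_set_def ext_domain_def digit_interval_def lo.region_def hi.region_def)

lemma region_disjoint: "lo.region c \<inter> hi.region c = {}"
  using a1_plus_le by (auto simp: lo.region_def hi.region_def)

lemma ext_density_measurable: "ext_density N \<in> borel_measurable borel"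
  unfolding ext_density_def borel_prod[symmetric] by measurable

lemma ext_density_nonneg: "0 \<le> ext_density N p"
  using N_pos by (cases p) (simp add: ext_density_def)

lemma nn_integral_sublevel:
  assumes "(lo.section_mass c has_integral I) {real_of_int a1..real_of_int a1 + 1}"
    and "(hi.section_mass c has_integral J) {real_of_int a2..real_of_int a2 + 1}"
  shows "(\<integral>\<^sup>+p. ennreal (ext_density N p) * indicator (sublevel_set a1 a2 N c) p \<partial>lborel) = ennreal (I + J)"
proof -
  note [measurable] = lo.region_measurable hi.region_measurable ext_density_measurable
  have "(\<integral>\<^sup>+p. ennreal (ext_density N p) * indicator (sublevel_set a1 a2 N c) p \<partial>lborel)
    = (\<integral>\<^sup>+p. ennreal (ext_density N p) * indicator (lo.region c) p
          + ennreal (ext_density N p) * indicator (hi.region c) p \<partial>lborel)"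
    using region_disjoint[of c] by (intro nn_integral_cong) (auto simp: sublevel_eq indicator_def)
  also have "\<dots> = (\<integral>\<^sup>+p. ennreal (ext_density N p) * indicator (lo.region c) p \<partial>lborel)
          + (\<integral>\<^sup>+p. ennreal (ext_density N p) * indicator (hi.region c) p \<partial>lborel)"
    by (rule nn_integral_add) auto
  also have "\<dots> = ennreal I + ennreal J"
    using lo.nn_integral_region[OF assms(1)] hi.nn_integral_region[OF assms(2)]
    by (simp add: ext_density_def)
  finally show ?thesis
    using lo.section_mass_integral_nonneg[OF assms(1)] hi.section_mass_integral_nonneg[OF assms(2)] by simp
qed

text \<open>The left side is the corner maximum for the first rectangle, the right side the corner
  minimum for the second. The denominators agree, so the claim reduces to
  \<open>a1 + 1 \<le> a2\<close>. Hence for each \<open>c\<close> at most one rectangle is partially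
  filled.\<close>

lemma threshold_between:
  "real_of_int N * (real_of_int a1 + 1) / (real_of_int N + real_of_int a2 * (real_of_int a1 + 1))
    \<le> real_of_int N * real_of_int a2 / (real_of_int N + real_of_int a2 * (real_of_int a1 + 1))"
  using a1_plus_le N_pos lo.pos[of "real_of_int a2" "real_of_int a1 + 1"] a1_nonneg a1_less
  by (intro divide_right_mono mult_left_mono) auto

text \<open>The quotient is at most \<open>x\<close>, hence below \<open>a2 + 1\<close> on the
  domain. The level \<open>a2 + 2\<close> also strictly exceeds both corner maxima, so the total
  mass is an instance of the sublevel computation.\<close>

lemma ext_domain_eq: "ext_domain a1 a2 = sublevel_set a1 a2 N (real_of_int a2 + 2)"
proof -
  have "real_of_int N * x / (real_of_int N + x * y) \<le> real_of_int a2 + 2"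
    if "(x, y) \<in> ext_domain a1 a2" for x y
  proof -
    have xy: "0 \<le> x" "0 \<le> y" "x \<le> real_of_int a2 + 2"
      using that a1_nonneg a1_less a1_plus_le by (auto simp: ext_domain_def digit_interval_def)
    then have "real_of_int N * x \<le> x * (real_of_int N + x * y)" by (simp add: algebra_simps)
    also have "\<dots> \<le> (real_of_int a2 + 2) * (real_of_int N + x * y)"
      using xy lo.pos[of x y] by (intro mult_right_mono) auto
    finally show ?thesis using lo.pos[of x y] xy by (simp add: divide_le_eq)
  qed
  then show ?thesis by (auto simp: sublevel_set_def)
qed

lemma nn_integral_domain:
  "(\<integral>\<^sup>+p. ennreal (ext_density N p) * indicator (ext_domain a1 a2) p \<partial>lborel) = ennreal (2 * full_mass)"
proof -
  have *: "real_of_int N * (x + 1) / (real_of_int N + y * (x + 1)) < real_of_int a2 + 2"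
    if "0 \<le> x" "0 \<le> y" "x \<le> real_of_int a2" for x y
  proof -
    have "real_of_int N * (x + 1) / (real_of_int N + y * (x + 1)) \<le> real_of_int N * (x + 1) / real_of_int N"
      using that N_pos by (intro divide_left_mono mult_pos_pos lo.pos) auto
    then show ?thesis using that N_pos by simp
  qed
  show ?thesis
    unfolding ext_domain_eq
    using nn_integral_sublevel[OF lo.section_mass_above[OF *] hi.section_mass_above[OF *]]
      a1_nonneg a1_less by (simp add: hi_full_mass)
qed

lemma norm_const_eq: "norm_const a1 a2 N = 1 / (2 * full_mass)"
proof -
  note [measurable] = lo.region_measurable hi.region_measurable ext_density_measurable
  have [measurable]: "ext_domain a1 a2 \<in> sets borel"
    unfolding ext_domain_eq sublevel_eq by measurable
  have "set_lebesgue_integral lborel (ext_domain a1 a2) (ext_density N)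
    = enn2real (\<integral>\<^sup>+p. ennreal (indicator (ext_domain a1 a2) p *\<^sub>R ext_density N p) \<partial>lborel)"
    unfolding set_lebesgue_integral_def
    by (rule integral_eq_nn_integral) (auto simp: ext_density_nonneg)
  also have "(\<integral>\<^sup>+p. ennreal (indicator (ext_domain a1 a2) p *\<^sub>R ext_density N p) \<partial>lborel)
    = (\<integral>\<^sup>+p. ennreal (ext_density N p) * indicator (ext_domain a1 a2) p \<partial>lborel)"
    by (intro nn_integral_cong) (auto simp: indicator_def)
  finally show ?thesis
    using lo.full_mass_pos by (simp add: norm_const_def nn_integral_domain divide_inverse)
qed

lemma measure_sublevel:
  assumes "(lo.section_mass c has_integral I) {real_of_int a1..real_of_int a1 + 1}"
    and "(hi.section_mass c has_integral J) {real_of_int a2..real_of_int a2 + 1}"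
  shows "measure (ext_measure a1 a2 N) (sublevel_set a1 a2 N c) = norm_const a1 a2 N * (I + J)"
proof -
  define C where "C = norm_const a1 a2 N"
  have C: "0 \<le> C" using lo.full_mass_pos by (simp add: C_def norm_const_eq)
  note [measurable] = lo.region_measurable hi.region_measurable ext_density_measurable
  have [measurable]: "sublevel_set a1 a2 N d \<in> sets borel" for d
    unfolding sublevel_eq by measurable
  have [measurable]: "ext_domain a1 a2 \<in> sets borel"
    unfolding ext_domain_eq by measurable
  have sub: "sublevel_set a1 a2 N c \<subseteq> ext_domain a1 a2" by (auto simp: sublevel_set_def)
  then have sets: "sublevel_set a1 a2 N c \<in> sets (restrict_space lborel (ext_domain a1 a2))"
    by (simp add: sets_restrict_space_iff)
  have "(\<lambda>p. ennreal (C * ext_density N p)) \<in> borel_measurable (restrict_space lborel (ext_domain a1 a2))"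
    by (intro measurable_restrict_space1) simp
  then have "emeasure (ext_measure a1 a2 N) (sublevel_set a1 a2 N c)
    = (\<integral>\<^sup>+p. ennreal (C * ext_density N p) * indicator (sublevel_set a1 a2 N c) p
        \<partial>restrict_space lborel (ext_domain a1 a2))"
    unfolding ext_measure_def C_def[symmetric] using sets by (rule emeasure_density)
  also have "\<dots> = (\<integral>\<^sup>+p. ennreal (C * ext_density N p) * indicator (sublevel_set a1 a2 N c) p
        * indicator (ext_domain a1 a2) p \<partial>lborel)"
    by (rule nn_integral_restrict_space) simp
  \<comment> \<open>The indicator of the domain is absorbed by that of its subset, and
    \<open>0 \<le> C\<close> lets the constant split off in \<open>ennreal\<close>.\<close>
  also have "\<dots> = (\<integral>\<^sup>+p. ennreal C * (ennreal (ext_density N p) * indicator (sublevel_set a1 a2 N c) p) \<partial>lborel)"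
    using sub C by (intro nn_integral_cong) (auto simp: indicator_def ennreal_mult ext_density_nonneg)
  also have "\<dots> = ennreal C * ennreal (I + J)"
    by (subst nn_integral_cmult) (simp_all add: nn_integral_sublevel[OF assms])
  also have "\<dots> = ennreal (C * (I + J))"
    using C lo.section_mass_integral_nonneg[OF assms(1)] hi.section_mass_integral_nonneg[OF assms(2)]
    by (simp add: ennreal_mult)
  finally show ?thesis
    using C lo.section_mass_integral_nonneg[OF assms(1)] hi.section_mass_integral_nonneg[OF assms(2)]
    by (simp add: measure_def C_def)
qed

lemma norm_const_full: "norm_const a1 a2 N * full_mass = 1 / 2"
  using lo.full_mass_pos by (simp add: norm_const_eq)

end

section \<open>Simplicity and assembly of the nine ranges\<close>

lemma simple_pair_le:
  assumes "0 < a2" "0 < N" "simple_pair a1 a2 N"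
  shows "a2 * (a2 + 1) \<le> N"
proof -
  have "a2 dvd N" "a2 + 1 dvd N" using assms by (auto simp: simple_pair_def)
  moreover have "coprime a2 (a2 + 1)" by simp
  ultimately have "a2 * (a2 + 1) dvd N" by (simp add: divides_mult)
  then show ?thesis using assms by (simp add: zdvd_imp_le)
qed

theorem theorem4p3:
  fixes a1 a2 N :: int and C :: real and F :: "real \<Rightarrow> real"
  assumes "0 \<le> a1" and "a1 < a2" and "0 < N"
    and "simple_pair a1 a2 N"
    and "C = norm_const a1 a2 N"
    and "F = (\<lambda>c. measure (ext_measure a1 a2 N) (sublevel_set a1 a2 N c))"
  shows
    "(\<forall>c \<in> {.. N * a1 / (N + a1 * (a2 + 1))}. F c = 0) \<and>
     (\<forall>c \<in> {N * a1 / (N + a1 * (a2 + 1)) <.. N * a1 / (N + a1 * a2)}.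
        F c = C * (c * (a2 + 1 + N / a1) / N - 1
                   - ln ((N * c + c * a1 * (a2 + 1)) / (a1 * N)))) \<and>
     (\<forall>c \<in> {N * a1 / (N + a1 * a2) <.. N * (a1 + 1) / (N + (a1 + 1) * (a2 + 1))}.
        F c = C * (- ln ((N + a1 * (a2 + 1)) / (N + a1 * a2)) + c / N)) \<and>
     (\<forall>c \<in> {N * (a1 + 1) / (N + (a1 + 1) * (a2 + 1)) <.. N * (a1 + 1) / (N + a2 * (a1 + 1))}.
        F c = C * (ln ((N * c + c * (a1 + 1) * (a2 + 1)) / (N * (a1 + 1))
                       * ((N + a1 * a2) / (N + a1 * (a2 + 1))))
                   + 1 - c / (a1 + 1) - c * a2 / N)) \<and>
     (\<forall>c \<in> {N * (a1 + 1) / (N + a2 * (a1 + 1)) <.. N * a2 / (N + a2 * (a1 + 1))}.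
        F c = 1 / 2) \<and>
     (\<forall>c \<in> {N * a2 / (N + a2 * (a1 + 1)) <.. N * a2 / (N + a1 * a2)}.
        F c = 1 / 2 + C * (c * (a1 + 1 + N / a2) / N - 1
                           - ln ((N * c + c * a2 * (a1 + 1)) / (a2 * N)))) \<and>
     (\<forall>c \<in> {N * a2 / (N + a1 * a2) <.. N * (a2 + 1) / (N + (a1 + 1) * (a2 + 1))}.
        F c = 1 / 2 + C * (- ln ((N + a2 * (a1 + 1)) / (N + a1 * a2)) + c / N)) \<and>
     (\<forall>c \<in> {N * (a2 + 1) / (N + (a1 + 1) * (a2 + 1)) <.. N * (a2 + 1) / (N + a1 * (a2 + 1))}.
        F c = 1 / 2 + C * (ln ((N * c + c * (a2 + 1) * (a1 + 1)) / (N * (a2 + 1))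
                               * ((N + a1 * a2) / (N + a2 * (a1 + 1))))
                           + 1 - c / (a2 + 1) - c * a1 / N)) \<and>
     (\<forall>c \<in> {N * (a2 + 1) / (N + a1 * (a2 + 1)) <..}. F c = 1)"
proof -
  interpret two_blocks N a1 a2
    using assms simple_pair_le[of a2 N a1] by unfold_locales auto
  \<comment> \<open>Exchanging the roles of \<open>a1\<close> and \<open>a2\<close> reverses some
    products; these rewrites restore the order used in the claimed formulas.\<close>
  note comm = mult.commute[of "real_of_int a2" "real_of_int a1"]
    mult.commute[of "real_of_int a2 + 1" "real_of_int a1 + 1"]
  note hi_mid = hi.section_mass_mid[unfolded comm] and hi_high = hi.section_mass_high[unfolded comm]
    and hi_low = hi.section_mass_low[unfolded comm]
  note thresholds = lo.threshold_mono threshold_between hi.threshold_mono[unfolded comm]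
  \<comment> \<open>Up to the corner minimum of the second rectangle, only the first
    contributes.\<close>
  have lower: "F c = C * I" if "(lo.section_mass c has_integral I) {real_of_int a1..real_of_int a1 + 1}"
    "c \<le> real_of_int N * real_of_int a2 / (real_of_int N + real_of_int a2 * (real_of_int a1 + 1))" for c I
    using measure_sublevel[OF that(1) hi.section_mass_below[OF that(2)]] assms(5,6) by simp
  \<comment> \<open>Beyond the corner maximum of the first rectangle, that rectangle contributes its
    whole mass, which is one half after normalization.\<close>
  have upper: "F c = 1 / 2 + C * J" if "(hi.section_mass c has_integral J) {real_of_int a2..real_of_int a2 + 1}"
    "real_of_int N * (real_of_int a1 + 1) / (real_of_int N + real_of_int a2 * (real_of_int a1 + 1)) < c" for c J
    using measure_sublevel[OF lo.section_mass_above[OF that(2)] that(1)] norm_const_full assms(5,6)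
    by (simp add: distrib_left)
  show ?thesis
    unfolding of_int_mult of_int_add of_int_1 Ball_def greaterThanAtMost_iff atMost_iff greaterThan_iff
  proof (intro conjI allI impI; (elim conjE)?)
    fix c :: real
    let ?N = "real_of_int N" and ?a = "real_of_int a1" and ?b = "real_of_int a2"
    {
      assume "c \<le> ?N * ?a / (?N + ?a * (?b + 1))"
      then show "F c = 0" using lower[OF lo.section_mass_below] thresholds by simp
    next
      assume "?N * ?a / (?N + ?a * (?b + 1)) < c" "c \<le> ?N * ?a / (?N + ?a * ?b)"
      then show "F c = C * (c * (?b + 1 + ?N / ?a) / ?N - 1 - ln ((?N * c + c * ?a * (?b + 1)) / (?a * ?N)))"
        using thresholds by (intro lower lo.section_mass_low) auto
    next
      assume "?N * ?a / (?N + ?a * ?b) < c" "c \<le> ?N * (?a + 1) / (?N + (?a + 1) * (?b + 1))"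
      then show "F c = C * (- ln ((?N + ?a * (?b + 1)) / (?N + ?a * ?b)) + c / ?N)"
        using thresholds by (intro lower lo.section_mass_mid) auto
    next
      assume "?N * (?a + 1) / (?N + (?a + 1) * (?b + 1)) < c" "c \<le> ?N * (?a + 1) / (?N + ?b * (?a + 1))"
      then show "F c = C * (ln ((?N * c + c * (?a + 1) * (?b + 1)) / (?N * (?a + 1))
          * ((?N + ?a * ?b) / (?N + ?a * (?b + 1)))) + 1 - c / (?a + 1) - c * ?b / ?N)"
        using thresholds by (intro lower lo.section_mass_high) auto
    next
      assume "?N * (?a + 1) / (?N + ?b * (?a + 1)) < c" "c \<le> ?N * ?b / (?N + ?b * (?a + 1))"
      then show "F c = 1 / 2" using upper[OF hi.section_mass_below] by simp
    next
      assume "?N * ?b / (?N + ?b * (?a + 1)) < c" "c \<le> ?N * ?b / (?N + ?a * ?b)"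
      then show "F c = 1 / 2 + C * (c * (?a + 1 + ?N / ?b) / ?N - 1
          - ln ((?N * c + c * ?b * (?a + 1)) / (?b * ?N)))"
        using thresholds by (intro upper hi_low) auto
    next
      assume "?N * ?b / (?N + ?a * ?b) < c" "c \<le> ?N * (?b + 1) / (?N + (?a + 1) * (?b + 1))"
      then show "F c = 1 / 2 + C * (- ln ((?N + ?b * (?a + 1)) / (?N + ?a * ?b)) + c / ?N)"
        using thresholds by (intro upper hi_mid) auto
    next
      assume "?N * (?b + 1) / (?N + (?a + 1) * (?b + 1)) < c" "c \<le> ?N * (?b + 1) / (?N + ?a * (?b + 1))"
      then show "F c = 1 / 2 + C * (ln ((?N * c + c * (?b + 1) * (?a + 1)) / (?N * (?b + 1))
          * ((?N + ?a * ?b) / (?N + ?b * (?a + 1)))) + 1 - c / (?b + 1) - c * ?a / ?N)"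
        using thresholds by (intro upper hi_high) auto
    next
      assume "?N * (?b + 1) / (?N + ?a * (?b + 1)) < c"
      then show "F c = 1"
        using upper[OF hi.section_mass_above] thresholds norm_const_full
        by (simp add: hi_full_mass assms(5))
    }
  qed
qed

end
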